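(* If $\mathfrak{g}$ is a real nilpotent Lie algebra of step two, then all Einstein metrics on $\mathfrak{g}$ are Ricci-flat.
   Context: Step two means that $[\mathfrak{g},[\mathfrak{g},\mathfrak{g}]]=0$, i.e. $[\mathfrak{g},\mathfrak{g}]$ is contained in the centre. A metric on a real Lie algebra $\mathfrak{g}$ is a non-degenerate symmetric bilinear form on $\mathfrak{g}$ of arbitrary signature; it is identified with the left-invariant pseudoriemannian metric it defines on a Lie group with Lie algebra $\mathfrak{g}$, and its Ricci operator $\operatorname{ric}\colon\mathfrak{g}\to\mathfrak{g}$ is that of this left-invariant metric. The metric is Einstein if $\operatorname{ric}=\lambda\,\mathrm{Id}$ for some $\lambda\in\mathbb{R}$, and Ricci-flat if $\operatorname{ric}=0$. *)

theory Defs
  imports "HOL-Analysis.Analysis"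
begin

section \<open>Lie algebras of step two\<close>

definition lie_algebra :: "('a::real_vector \<Rightarrow> 'a \<Rightarrow> 'a) \<Rightarrow> bool" where
  "lie_algebra br \<longleftrightarrow> bilinear br \<and> (\<forall>x. br x x = 0) \<and>
    (\<forall>x y z. br x (br y z) + br y (br z x) + br z (br x y) = 0)"

definition bracket_space ::
    "('a::real_vector \<Rightarrow> 'a \<Rightarrow> 'a) \<Rightarrow> 'a set \<Rightarrow> 'a set \<Rightarrow> 'a set" where
  "bracket_space br U V = span {br u v | u v. u \<in> U \<and> v \<in> V}"

definition step_two :: "('a::real_vector \<Rightarrow> 'a \<Rightarrow> 'a) \<Rightarrow> bool" where
  "step_two br \<longleftrightarrow> bracket_space br UNIV (bracket_space br UNIV UNIV) = {0}"

definition finite_dim :: "'a::real_vector itself \<Rightarrow> bool" where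
  "finite_dim _ \<longleftrightarrow> (\<exists>B::'a set. finite B \<and> span B = UNIV)"


section \<open>Trace of an endomorphism\<close>

text \<open>The choice of basis is immaterial on finite-dimensional spaces, see
  \<open>endo_trace_eq\<close> below.\<close>

definition endo_trace :: "('a::real_vector \<Rightarrow> 'a) \<Rightarrow> real" where
  "endo_trace f = (let B = (SOME B. independent B \<and> span B = UNIV)
                   in \<Sum>b\<in>B. representation B (f b) b)"


section \<open>Metrics and their curvature\<close>

definition lie_metric :: "('a::real_vector \<Rightarrow> 'a \<Rightarrow> real) \<Rightarrow> bool" where
  "lie_metric g \<longleftrightarrow> bilinear g \<and> (\<forall>x y. g x y = g y x) \<and>
    (\<forall>x. (\<forall>y. g x y = 0) \<longrightarrow> x = 0)"

text \<open>
  The Lie algebra consists of the left-invariant vector fields on the Lie group. The Levi-Civita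
  connection of a left-invariant metric is itself left-invariant, so it is determined by its values
  \<open>nab x y\<close> on left-invariant fields. For these fields \<open>g y z\<close> is a constant function, so that
  compatibility with the metric, \<open>x (g y z) = g (nab x y) z + g y (nab x z)\<close>, has
  left-hand side zero.
\<close>

definition is_levi_civita ::
    "('a::real_vector \<Rightarrow> 'a \<Rightarrow> 'a) \<Rightarrow> ('a \<Rightarrow> 'a \<Rightarrow> real) \<Rightarrow> ('a \<Rightarrow> 'a \<Rightarrow> 'a) \<Rightarrow> bool" where
  "is_levi_civita br g nab \<longleftrightarrow> bilinear nab \<and>
    (\<forall>x y. nab x y - nab y x = br x y) \<and>
    (\<forall>x y z. g (nab x y) z + g y (nab x z) = 0)"

definition levi_civita ::
    "('a::real_vector \<Rightarrow> 'a \<Rightarrow> 'a) \<Rightarrow> ('a \<Rightarrow> 'a \<Rightarrow> real) \<Rightarrow> 'a \<Rightarrow> 'a \<Rightarrow> 'a" where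
  "levi_civita br g = (THE nab. is_levi_civita br g nab)"

definition riemann ::
    "('a::real_vector \<Rightarrow> 'a \<Rightarrow> 'a) \<Rightarrow> ('a \<Rightarrow> 'a \<Rightarrow> real) \<Rightarrow> 'a \<Rightarrow> 'a \<Rightarrow> 'a \<Rightarrow> 'a" where
  "riemann br g x y z =
    (let nab = levi_civita br g in nab x (nab y z) - nab y (nab x z) - nab (br x y) z)"

definition ricci_tensor ::
    "('a::real_vector \<Rightarrow> 'a \<Rightarrow> 'a) \<Rightarrow> ('a \<Rightarrow> 'a \<Rightarrow> real) \<Rightarrow> 'a \<Rightarrow> 'a \<Rightarrow> real" where
  "ricci_tensor br g y z = endo_trace (\<lambda>x. riemann br g x y z)"

definition ricci_operator ::
    "('a::real_vector \<Rightarrow> 'a \<Rightarrow> 'a) \<Rightarrow> ('a \<Rightarrow> 'a \<Rightarrow> real) \<Rightarrow> 'a \<Rightarrow> 'a" where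
  "ricci_operator br g = (THE ric. \<forall>y z. g (ric y) z = ricci_tensor br g y z)"

definition einstein :: "('a::real_vector \<Rightarrow> 'a \<Rightarrow> 'a) \<Rightarrow> ('a \<Rightarrow> 'a \<Rightarrow> real) \<Rightarrow> bool" where
  "einstein br g \<longleftrightarrow> (\<exists>c. ricci_operator br g = (\<lambda>x. c *\<^sub>R x))"

definition ricci_flat :: "('a::real_vector \<Rightarrow> 'a \<Rightarrow> 'a) \<Rightarrow> ('a \<Rightarrow> 'a \<Rightarrow> real) \<Rightarrow> bool" where
  "ricci_flat br g \<longleftrightarrow> ricci_operator br g = (\<lambda>x. 0)"


section \<open>The notions above are well defined\<close>

lemma finite_dim_basis:
  assumes "finite_dim TYPE('a::real_vector)"
  obtains B :: "'a::real_vector set" where "finite B" "independent B" "span B = UNIV"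
proof -
  obtain C :: "'a set" where C: "finite C" "span C = UNIV"
    using assms unfolding finite_dim_def by auto
  obtain B :: "'a set" where B: "B \<subseteq> UNIV" "independent B" "UNIV \<subseteq> span B"
    using maximal_independent_subset[of "UNIV::'a set"] by metis
  have "finite B"
    using independent_span_bound[OF C(1) B(2)] C(2) by auto
  then show ?thesis using B that by auto
qed

lemma finite_dim_independent_finite:
  assumes "finite_dim TYPE('a::real_vector)" "independent (B :: 'a::real_vector set)"
  shows "finite B"
  using assms independent_span_bound unfolding finite_dim_def by (metis subset_UNIV)

lemma sum_representation_basis:
  assumes "finite B" "independent B" "span B = UNIV"
  shows "(\<Sum>b\<in>B. representation B v b *\<^sub>R b) = v"
  using assms by (intro real_vector.sum_representation_eq) auto

lemma linear_representation_basis: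
  fixes B :: "'a::real_vector set"
  assumes "independent B" "span B = UNIV"
  shows "linear (\<lambda>v. representation B v b)"
  using real_vector.representation_add[OF assms(1)] real_vector.representation_scale[OF assms(1)]
    assms(2)
  by (intro linearI) auto

lemma trace_basis_independent:
  fixes f :: "'a::real_vector \<Rightarrow> 'a"
  assumes f: "linear f"
    and B: "finite B" "independent B" "span B = UNIV"
    and C: "finite C" "independent C" "span C = UNIV"
  shows "(\<Sum>b\<in>B. representation B (f b) b) = (\<Sum>c\<in>C. representation C (f c) c)"
proof -
  have 1: "representation B (f b) b = (\<Sum>c\<in>C. representation C b c * representation B (f c) b)" for b
  proof -
    interpret r: linear "\<lambda>v. representation B v b"
      by (rule linear_representation_basis[OF B(2,3)])
    have "f b = f (\<Sum>c\<in>C. representation C b c *\<^sub>R c)"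
      by (simp add: sum_representation_basis[OF C])
    also have "\<dots> = (\<Sum>c\<in>C. representation C b c *\<^sub>R f c)"
      by (simp add: linear_sum[OF f] linear_scale[OF f])
    finally have "representation B (f b) b
        = representation B (\<Sum>c\<in>C. representation C b c *\<^sub>R f c) b" by simp
    then show ?thesis by (simp add: r.sum r.scale)
  qed
  have 2: "(\<Sum>b\<in>B. representation C b c * representation B (f c) b) = representation C (f c) c" for c
  proof -
    interpret r: linear "\<lambda>v. representation C v c"
      by (rule linear_representation_basis[OF C(2,3)])
    have "representation C (f c) c
        = representation C (\<Sum>b\<in>B. representation B (f c) b *\<^sub>R b) c"
      by (simp add: sum_representation_basis[OF B])
    then show ?thesis by (simp add: r.sum r.scale mult.commute)
  qed
  have "(\<Sum>b\<in>B. representation B (f b) b)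
      = (\<Sum>b\<in>B. \<Sum>c\<in>C. representation C b c * representation B (f c) b)"
    using 1 by simp
  also have "\<dots> = (\<Sum>c\<in>C. \<Sum>b\<in>B. representation C b c * representation B (f c) b)"
    by (rule sum.swap)
  also have "\<dots> = (\<Sum>c\<in>C. representation C (f c) c)"
    using 2 by simp
  finally show ?thesis .
qed

lemma endo_trace_some_basis:
  assumes "finite_dim TYPE('a::real_vector)"
  obtains B :: "'a::real_vector set" where "finite B" "independent B" "span B = UNIV"
    "\<And>f. endo_trace f = (\<Sum>b\<in>B. representation B (f b) b)"
proof -
  define B :: "'a set" where "B = (SOME B. independent B \<and> span B = UNIV)"
  obtain B0 :: "'a set" where "independent B0" "span B0 = UNIV"
    by (rule finite_dim_basis[OF assms]) auto
  then have B: "independent B \<and> span B = UNIV"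
    unfolding B_def by (intro someI_ex[of "\<lambda>B. independent B \<and> span B = UNIV"]) auto
  show ?thesis
    by (rule that[of B])
      (use B finite_dim_independent_finite[OF assms] in \<open>auto simp: endo_trace_def B_def Let_def\<close>)
qed

lemma endo_trace_eq:
  fixes f :: "'a::real_vector \<Rightarrow> 'a"
  assumes "linear f" "finite C" "independent C" "span C = UNIV"
  shows "endo_trace f = (\<Sum>c\<in>C. representation C (f c) c)"
proof -
  have "finite_dim TYPE('a)" using assms unfolding finite_dim_def by auto
  then obtain B :: "'a set" where B: "finite B" "independent B" "span B = UNIV"
    "\<And>f. endo_trace f = (\<Sum>b\<in>B. representation B (f b) b)"
    by (rule endo_trace_some_basis) auto
  show ?thesis
    unfolding B(4) by (rule trace_basis_independent[OF assms(1) B(1-3) assms(2-4)])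
qed

lemma metric_represents:
  fixes g :: "'a::real_vector \<Rightarrow> 'a \<Rightarrow> real"
  assumes fd: "finite_dim TYPE('a)" and g: "lie_metric g" and p: "linear p"
  obtains v where "\<And>z. g v z = p z"
proof -
  obtain B :: "'a set" where B: "finite B" "independent B" "span B = UNIV"
    by (rule finite_dim_basis[OF fd]) auto
  interpret fdv: finite_dimensional_vector_space "scaleR :: real \<Rightarrow> 'a \<Rightarrow> 'a" B
    by unfold_locales (use B in \<open>auto simp: dependent_raw_def span_raw_def\<close>)
  have bil: "bilinear g" using g by (simp add: lie_metric_def)
  define T where "T v = (\<Sum>b\<in>B. g v b *\<^sub>R b)" for v
  have lT: "linear T"
    by (rule linearI)
      (simp_all add: T_def bilinear_ladd[OF bil] bilinear_lmul[OF bil] scaleR_add_left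
        sum.distrib scaleR_sum_right)
  have ext: "g v z = q z" if "linear q" "\<And>b. b \<in> B \<Longrightarrow> g v b = q b" for v z q
  proof -
    have "linear (g v)" using bil by (simp add: bilinear_def)
    then show ?thesis
      using linear_eq_on_span[of "g v" q B z] that B(3) by auto
  qed
  have indep: "c b = d b" if "(\<Sum>b\<in>B. c b *\<^sub>R b) = (\<Sum>b\<in>B. d b *\<^sub>R b)" "b \<in> B"
    for c d :: "'a \<Rightarrow> real" and b
  proof -
    have "(\<Sum>b\<in>B. (c b - d b) *\<^sub>R b) = 0"
      using that(1) by (simp add: scaleR_diff_left sum_subtractf)
    then have "c b - d b = 0"
      using independentD[OF B(2) B(1) subset_refl, of "\<lambda>b. c b - d b" b] that(2) by simp
    then show ?thesis by simp
  qed
  have "inj T"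
    unfolding linear_inj_iff_eq_0[OF lT]
  proof (intro allI impI)
    fix v assume "T v = 0"
    then have "g v b = 0" if "b \<in> B" for b
      using indep[of "g v" "\<lambda>_. 0" b] that by (simp add: T_def)
    then have "g v z = 0" for z
      using ext[of "\<lambda>_. 0" v z] by (simp add: linear_zero)
    then show "v = 0" using g by (auto simp: lie_metric_def)
  qed
  then have "surj T"
    using fdv.linear_inj_imp_surj[of T] lT by (simp add: linear_def)
  then obtain v where "T v = (\<Sum>b\<in>B. p b *\<^sub>R b)" by (metis surjD)
  then have "g v z = p z" for z
    using indep[of "g v" p] ext[OF p, of v z] by (simp add: T_def)
  then show ?thesis by (rule that)
qed

lemma lie_metric_cancel:
  assumes "lie_metric g" "\<And>z. g x z = g y z"
  shows "x = y"
proof -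
  have "bilinear g" using assms(1) by (simp add: lie_metric_def)
  then have "\<forall>z. g (x - y) z = 0" using assms(2) by (simp add: bilinear_lsub)
  then have "x - y = 0" using assms(1) unfolding lie_metric_def by blast
  then show ?thesis by simp
qed

lemma lie_algebra_antisym:
  assumes "lie_algebra br" shows "br x y = - br y x"
proof -
  have bil: "bilinear br" and alt: "\<And>x. br x x = 0" using assms by (auto simp: lie_algebra_def)
  have "br (x + y) (x + y) = br x x + br x y + (br y x + br y y)"
    by (simp add: bilinear_ladd[OF bil] bilinear_radd[OF bil] algebra_simps)
  then have "br x y + br y x = 0" by (simp add: alt)
  then show ?thesis by (simp add: add_eq_0_iff2)
qed

lemma is_levi_civita_koszul:
  assumes g: "lie_metric g" and lc: "is_levi_civita br g nab"
  shows "2 * g (nab x y) z = g (br x y) z - g (br y z) x + g (br z x) y"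
proof -
  have bil: "bilinear g" and sym: "\<And>x y. g x y = g y x" using g by (auto simp: lie_metric_def)
  have br: "br x y = nab x y - nab y x" for x y using lc by (simp add: is_levi_civita_def)
  have m: "g (nab x y) z = - g (nab x z) y" for x y z
    using lc sym[of y "nab x z"] unfolding is_levi_civita_def
    by (metis add_eq_0_iff2)
  show ?thesis
    unfolding br bilinear_lsub[OF bil]
    using m[of x y z] m[of y x z] m[of z x y] by simp
qed

lemma is_levi_civita_exists:
  fixes g :: "'a::real_vector \<Rightarrow> 'a \<Rightarrow> real"
  assumes fd: "finite_dim TYPE('a)" and L: "lie_algebra br" and g: "lie_metric g"
  shows "\<exists>nab. is_levi_civita br g nab"
proof -
  have bil: "bilinear g" and sym: "\<And>x y. g x y = g y x" using g by (auto simp: lie_metric_def)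
  have bb: "bilinear br" using L by (auto simp: lie_algebra_def)
  define k where "k x y z = (g (br x y) z - g (br y z) x + g (br z x) y) / 2" for x y z
  note lin = bilinear_ladd[OF bil] bilinear_radd[OF bil] bilinear_lmul[OF bil]
    bilinear_rmul[OF bil] bilinear_ladd[OF bb] bilinear_radd[OF bb] bilinear_lmul[OF bb]
    bilinear_rmul[OF bb] bilinear_lneg[OF bil] bilinear_lsub[OF bil]
  have "linear (k x y)" for x y
    by (rule linearI) (simp_all add: k_def lin algebra_simps add_divide_distrib diff_divide_distrib)
  then have "\<exists>v. \<forall>z. g v z = k x y z" for x y
    using metric_represents[OF fd g] by metis
  then obtain nab where nab: "\<And>x y z. g (nab x y) z = k x y z" by metis
  have "bilinear nab"
    unfolding bilinear_def
    by (intro conjI allI linearI; rule lie_metric_cancel[OF g])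
      (simp_all add: lin nab k_def algebra_simps add_divide_distrib diff_divide_distrib)
  moreover have anti: "g (br u v) w = - g (br v u) w" for u v w
    using lie_algebra_antisym[OF L, of u v] by (simp add: bilinear_lneg[OF bil])
  moreover have "nab x y - nab y x = br x y" for x y
  proof (rule lie_metric_cancel[OF g])
    fix z
    show "g (nab x y - nab y x) z = g (br x y) z"
      unfolding bilinear_lsub[OF bil] nab k_def
      by (simp add: anti[of y x z] anti[of x z y] anti[of z y x] diff_divide_distrib add_divide_distrib)
  qed
  moreover have "g (nab x y) z + g y (nab x z) = 0" for x y z
    unfolding sym[of y] nab k_def
    by (simp add: anti[of y x z] anti[of x z y] anti[of z y x] diff_divide_distrib add_divide_distrib)
  ultimately show ?thesis unfolding is_levi_civita_def by blast
qed

lemma is_levi_civita_unique: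
  assumes g: "lie_metric g" and "is_levi_civita br g nab" "is_levi_civita br g nab'"
  shows "nab = nab'"
proof (intro ext)
  fix x y
  show "nab x y = nab' x y"
  proof (rule lie_metric_cancel[OF g])
    fix z show "g (nab x y) z = g (nab' x y) z"
      using is_levi_civita_koszul[OF g assms(2), of x y z]
        is_levi_civita_koszul[OF g assms(3), of x y z] by simp
  qed
qed

lemma levi_civita:
  fixes g :: "'a::real_vector \<Rightarrow> 'a \<Rightarrow> real"
  assumes "finite_dim TYPE('a)" "lie_algebra br" "lie_metric g"
  shows "is_levi_civita br g (levi_civita br g)"
  unfolding levi_civita_def
  using is_levi_civita_exists[OF assms] is_levi_civita_unique[OF assms(3)] by (metis theI)

lemma ricci_operator:
  fixes g :: "'a::real_vector \<Rightarrow> 'a \<Rightarrow> real"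
  assumes fd: "finite_dim TYPE('a)" and L: "lie_algebra br" and g: "lie_metric g"
  shows "g (ricci_operator br g y) z = ricci_tensor br g y z"
proof -
  have bn: "bilinear (levi_civita br g)"
    using levi_civita[OF assms] by (simp add: is_levi_civita_def)
  note nl = bilinear_radd[OF bn] bilinear_rmul[OF bn]
  obtain B :: "'a set" where B: "finite B" "independent B" "span B = UNIV"
    "\<And>f. endo_trace f = (\<Sum>b\<in>B. representation B (f b) b)"
    by (rule endo_trace_some_basis[OF fd]) auto
  have "linear (ricci_tensor br g y)" for y
    unfolding ricci_tensor_def B(4)
  proof (rule linear_compose_sum, intro ballI)
    fix b
    have "linear (\<lambda>z. riemann br g b y z)"
      by (rule linearI) (simp_all add: riemann_def Let_def nl algebra_simps)
    from linear_compose[OF this linear_representation_basis[OF B(2,3)]]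
    show "linear (\<lambda>z. representation B (riemann br g b y z) b)" by (simp add: o_def)
  qed
  then have "\<exists>v. \<forall>z. g v z = ricci_tensor br g y z" for y
    using metric_represents[OF fd g] by metis
  then obtain ric where ric: "\<forall>y z. g (ric y) z = ricci_tensor br g y z" by metis
  have "\<forall>y z. g (ricci_operator br g y) z = ricci_tensor br g y z"
    unfolding ricci_operator_def
    by (rule theI[of _ ric])
      (use ric in \<open>auto intro!: ext lie_metric_cancel[OF g]\<close>)
  then show ?thesis by blast
qed

lemma step_two_iff:
  assumes "lie_algebra br"
  shows "step_two br \<longleftrightarrow> (\<forall>x y z. br x (br y z) = 0)"
proof
  assume s: "step_two br"
  show "\<forall>x y z. br x (br y z) = 0"
  proof (intro allI)
    fix x y z
    have "br y z \<in> bracket_space br UNIV UNIV"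
      unfolding bracket_space_def by (rule span_base) auto
    then have "br x (br y z) \<in> bracket_space br UNIV (bracket_space br UNIV UNIV)"
      by (subst bracket_space_def) (rule span_base, auto)
    then show "br x (br y z) = 0" using s by (simp add: step_two_def)
  qed
next
  assume h: "\<forall>x y z. br x (br y z) = 0"
  have bil: "bilinear br" using assms by (simp add: lie_algebra_def)
  have "br x w = 0" if "w \<in> bracket_space br UNIV UNIV" for x w
  proof -
    have "linear (br x)" using bil by (simp add: bilinear_def)
    then show ?thesis
      using linear_eq_0_on_span[of "br x" "{br u v | u v. u \<in> UNIV \<and> v \<in> UNIV}" w] h that
      by (auto simp: bracket_space_def)
  qed
  then have "{br u v | u v. u \<in> UNIV \<and> v \<in> bracket_space br UNIV UNIV} \<subseteq> {0}" by auto
  then have "bracket_space br UNIV (bracket_space br UNIV UNIV) \<subseteq> span {0}"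
    by (subst bracket_space_def) (rule span_mono)
  then show "step_two br"
    unfolding step_two_def by (auto simp: bracket_space_def intro: span_zero)
qed

end

theory Submission
  imports Defs
begin

text \<open>
  For step two the Ricci tensor is \<open>ric(y,z) = - tr (N\<^sub>y N\<^sub>z)\<close> with \<open>N\<^sub>y x = nab x y\<close>, which the Koszul
  formula turns into
  \<open>4 ric(y,z) = \<Sum> g([e\<^sub>j,e\<^sub>k],y) g([e\<^sup>j,e\<^sup>k],z) - 2 \<Sum> g([y,e\<^sub>j],[z,e\<^sup>j])\<close>
  for dual bases. Put \<open>S = \<Sum> g([e\<^sub>i,e\<^sub>j],[e\<^sup>i,e\<^sup>j])\<close>. Then \<open>4 tr ric = S - 2 S = - S\<close>, whereas
  \<open>4 tr (ric P) = S\<close> for any projection \<open>P\<close> onto the derived algebra, which is central. If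
  \<open>ric = c Id\<close>, adding the two gives \<open>c (dim V + tr P) = 0\<close>, so \<open>c = 0\<close>. (Here \<open>Id + P\<close> is a
  derivation of nonzero trace.)
\<close>

section \<open>Dual bases and contractions in arbitrary signature\<close>

text \<open>Orthonormal bases are avoided, so the signature never enters: \<open>d b\<close>
  represents the coordinate functional of \<open>b\<close>. For \<open>b\<close> outside
  \<open>B\<close> this functional is zero, hence \<open>d b = 0\<close>.\<close>

locale dual_bases =
  fixes g :: "'a::real_vector \<Rightarrow> 'a \<Rightarrow> real" and B :: "'a set" and d :: "'a \<Rightarrow> 'a"
  assumes metric: "lie_metric g"
    and fin: "finite B" and indep: "independent B" and span_UNIV: "span B = UNIV"
    and dual: "g (d b) v = representation B v b"
begin

lemma bil: "bilinear g"
  using metric by (simp add: lie_metric_def)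

lemma sym: "g x y = g y x"
  using metric by (simp add: lie_metric_def)

lemmas glin = bilinear_ladd[OF bil] bilinear_radd[OF bil] bilinear_lmul[OF bil]
  bilinear_rmul[OF bil] bilinear_lneg[OF bil] bilinear_rneg[OF bil]
  bilinear_lsub[OF bil] bilinear_rsub[OF bil]

lemma linear_g: "linear (g x)"
  using bil by (simp add: bilinear_def)

lemma dual_self: "b \<in> B \<Longrightarrow> g b (d b) = 1"
  by (simp add: sym[of b] dual representation_basis[OF indep])

lemma expand: "(\<Sum>b\<in>B. g (d b) v *\<^sub>R b) = v"
  by (simp add: dual sum_representation_basis[OF fin indep span_UNIV])

lemma linear_expand:
  fixes f :: "'a \<Rightarrow> real"
  assumes "linear f"
  shows "f v = (\<Sum>b\<in>B. g (d b) v * f b)"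
proof -
  have "f v = f (\<Sum>b\<in>B. g (d b) v *\<^sub>R b)" by (simp add: expand)
  also have "\<dots> = (\<Sum>b\<in>B. g (d b) v * f b)"
    by (simp add: linear_sum[OF assms] linear_scale[OF assms])
  finally show ?thesis .
qed

lemma contract: "(\<Sum>b\<in>B. g u b * g v (d b)) = g u v"
  using linear_expand[OF linear_g, of u v] by (simp add: sym mult.commute)

text \<open>Both sides contract \<open>h\<close> with the inverse metric, whose matrix
  \<open>g (d e) (d b)\<close> is symmetric. So the dual vector may be moved to either slot.\<close>

lemma contraction_swap:
  fixes h :: "'a \<Rightarrow> 'a \<Rightarrow> real"
  assumes l: "\<And>y. linear (\<lambda>x. h x y)" and r: "\<And>x. linear (h x)"
  shows "(\<Sum>b\<in>B. h b (d b)) = (\<Sum>b\<in>B. h (d b) b)"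
proof -
  have "(\<Sum>b\<in>B. h b (d b)) = (\<Sum>b\<in>B. \<Sum>e\<in>B. g (d e) (d b) * h b e)"
    by (subst linear_expand[OF r]) simp
  also have "\<dots> = (\<Sum>e\<in>B. \<Sum>b\<in>B. g (d e) (d b) * h b e)"
    by (rule sum.swap)
  also have "\<dots> = (\<Sum>e\<in>B. h (d e) e)"
    by (subst (2) linear_expand[OF l]) (simp add: sym)
  finally show ?thesis .
qed

lemma linear_expand_dual:
  fixes f :: "'a \<Rightarrow> real"
  assumes "linear f"
  shows "f v = (\<Sum>b\<in>B. g v b * f (d b))"
proof -
  have "(\<Sum>b\<in>B. g v b * f (d b)) = (\<Sum>b\<in>B. g v (d b) * f b)"
    by (rule contraction_swap)
      (auto intro!: linearI simp: glin linear_add[OF assms] linear_scale[OF assms] algebra_simps)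
  then show ?thesis
    by (simp add: linear_expand[OF assms, of v] sym[of v])
qed

lemma endo_trace_dual:
  assumes "linear f"
  shows "endo_trace f = (\<Sum>b\<in>B. g (f b) (d b))"
  using endo_trace_eq[OF assms fin indep span_UNIV] by (simp add: sym[of _ "d _"] dual)

lemma trace_compose:
  assumes "linear f"
  shows "(\<Sum>b\<in>B. g (f (h b)) (d b)) = (\<Sum>b\<in>B. \<Sum>e\<in>B. g (f e) (d b) * g (h b) (d e))"
proof (rule sum.cong[OF refl])
  fix b
  have "linear (\<lambda>v. g (f v) (d b))"
    by (rule linearI) (simp_all add: linear_add[OF assms] linear_scale[OF assms] glin)
  from linear_expand[OF this, of "h b"]
  show "g (f (h b)) (d b) = (\<Sum>e\<in>B. g (f e) (d b) * g (h b) (d e))"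
    by (simp add: sym[of "d _" "h b"] mult.commute)
qed

lemma trace_commute:
  assumes "linear f" "linear h"
  shows "(\<Sum>b\<in>B. g (f (h b)) (d b)) = (\<Sum>b\<in>B. g (h (f b)) (d b))"
  unfolding trace_compose[OF assms(1)] trace_compose[OF assms(2)]
  by (subst sum.swap) (simp add: mult.commute)

end

text \<open>\<open>C\<close> plays the role of a basis of the derived algebra, extended to the basis \<open>B\<close>; the
  condition \<open>C_derived\<close> says that brackets have no component along \<open>B - C\<close>.\<close>

locale step_two_dual_bases = dual_bases g B d
  for g :: "'a::real_vector \<Rightarrow> 'a \<Rightarrow> real" and B d +
  fixes br :: "'a \<Rightarrow> 'a \<Rightarrow> 'a" and C :: "'a set"
  assumes lie: "lie_algebra br" and step: "br x (br y z) = 0"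
    and C_subset: "C \<subseteq> B" and C_central: "b \<in> C \<Longrightarrow> br x b = 0"
    and C_derived: "b \<notin> C \<Longrightarrow> g (br x y) (d b) = 0"
begin

section \<open>Connection and Ricci tensor of a step-two algebra\<close>

lemma br_bil: "bilinear br"
  using lie by (simp add: lie_algebra_def)

lemmas blin = bilinear_ladd[OF br_bil] bilinear_radd[OF br_bil] bilinear_lmul[OF br_bil]
  bilinear_rmul[OF br_bil] bilinear_lneg[OF br_bil] bilinear_rneg[OF br_bil]

lemma antisym: "br x y = - br y x"
  by (rule lie_algebra_antisym[OF lie])

lemma linear_br: "linear (br x)"
  using br_bil by (simp add: bilinear_def)

text \<open>Unimodularity, seen on each diagonal entry: a \<open>b\<close> in \<open>C\<close> is
  central, and brackets have no component along any other \<open>b\<close>.\<close>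

lemma trace_ad: "(\<Sum>b\<in>B. g (br z b) (d b)) = 0"
proof (rule sum.neutral, rule ballI)
  fix b show "g (br z b) (d b) = 0"
    by (cases "b \<in> C") (simp_all add: C_central C_derived bilinear_lzero[OF bil])
qed

abbreviation "nab \<equiv> levi_civita br g"

lemma lc: "is_levi_civita br g nab"
proof -
  have "finite_dim TYPE('a)" using fin span_UNIV by (auto simp: finite_dim_def)
  then show ?thesis by (rule levi_civita[OF _ lie metric])
qed

lemma nab_bil: "bilinear nab"
  using lc by (simp add: is_levi_civita_def)

lemmas nlin = bilinear_ladd[OF nab_bil] bilinear_radd[OF nab_bil] bilinear_lmul[OF nab_bil]
  bilinear_rmul[OF nab_bil] bilinear_lneg[OF nab_bil]

lemma linear_nab_left: "linear (\<lambda>x. nab x y)"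
  using nab_bil by (simp add: bilinear_def)

lemma torsion_free: "nab x y = nab y x + br x y"
proof -
  have "nab x y - nab y x = br x y" using lc by (simp add: is_levi_civita_def)
  then show ?thesis by (simp add: algebra_simps)
qed

lemma koszul: "2 * g (nab x y) z = - (g (br y x) z + g (br y z) x + g (br x z) y)"
proof -
  have "g (br u v) w = - g (br v u) w" for u v w
    by (subst antisym) (simp add: glin)
  from this[of x y z] this[of z x y] show ?thesis
    using is_levi_civita_koszul[OF metric lc, of x y z] by linarith
qed

text \<open>By the Koszul formula the trace consists of two copies of the trace of ad
  \<open>w\<close>, which vanish, and of the skew bracket contracted with the symmetric inverse
  metric.\<close>

lemma divergence_free: "(\<Sum>b\<in>B. g (nab b w) (d b)) = 0"
proof -
  have sw: "(\<Sum>b\<in>B. g (br w (d b)) b) = (\<Sum>b\<in>B. g (br w b) (d b))"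
    by (rule contraction_swap[symmetric]) (auto intro!: linearI simp: glin blin)
  have "(\<Sum>b\<in>B. g (br b (d b)) w) = (\<Sum>b\<in>B. g (br (d b) b) w)"
    by (rule contraction_swap) (auto intro!: linearI simp: glin blin)
  also have "\<dots> = - (\<Sum>b\<in>B. g (br b (d b)) w)"
    by (subst antisym) (simp add: glin sum_negf)
  finally have "(\<Sum>b\<in>B. g (br b (d b)) w) = 0" by simp
  moreover have "2 * (\<Sum>b\<in>B. g (nab b w) (d b))
      = - ((\<Sum>b\<in>B. g (br w b) (d b)) + (\<Sum>b\<in>B. g (br w (d b)) b) + (\<Sum>b\<in>B. g (br b (d b)) w))"
    unfolding sum_distrib_left koszul by (simp add: sum.distrib sum_negf sum_subtractf)
  ultimately show ?thesis using sw trace_ad by simp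
qed

lemma ricci_tensor_trace: "ricci_tensor br g y z = - (\<Sum>b\<in>B. g (nab (nab b z) y) (d b))"
proof -
  have lin: "linear (\<lambda>x. riemann br g x y z)"
    by (rule linearI) (simp_all add: riemann_def Let_def nlin blin algebra_simps)
  \<comment> \<open>Exchanging \<open>y\<close> and \<open>nab b z\<close> by torsion-freeness
    isolates the wanted trace. The first term will be a divergence, and the last two cancel by
    cyclicity of the trace.\<close>
  have "g (riemann br g b y z) (d b) = g (nab b (nab y z)) (d b) - g (nab (nab b z) y) (d b)
      - g (br y (nab b z)) (d b) + g (nab (br y b) z) (d b)" for b
    unfolding riemann_def Let_def torsion_free[of y "nab b z"] antisym[of b y]
    by (simp add: glin nlin)
  then have "ricci_tensor br g y z = (\<Sum>b\<in>B. g (nab b (nab y z)) (d b))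
      - (\<Sum>b\<in>B. g (nab (nab b z) y) (d b))
      - (\<Sum>b\<in>B. g (br y (nab b z)) (d b)) + (\<Sum>b\<in>B. g (nab (br y b) z) (d b))"
    unfolding ricci_tensor_def endo_trace_dual[OF lin] by (simp add: sum.distrib sum_subtractf)
  moreover have "(\<Sum>b\<in>B. g (br y (nab b z)) (d b)) = (\<Sum>b\<in>B. g (nab (br y b) z) (d b))"
    by (rule trace_commute[OF linear_br linear_nab_left])
  ultimately show ?thesis by (simp add: divergence_free)
qed

lemma ricci_tensor_formula:
  "4 * ricci_tensor br g y z =
    (\<Sum>e\<in>B. \<Sum>b\<in>B. g (br e b) y * g (br (d e) (d b)) z) - 2 * (\<Sum>e\<in>B. g (br y e) (br z (d e)))"
proof -
  \<comment> \<open>The Koszul formula reads \<open>- 2 * g (nab u y) v = s y u v + k y u v\<close>,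
    with \<open>s\<close> symmetric and \<open>k\<close> skew in \<open>u\<close>, \<open>v\<close>.
    The pairing \<open>t\<close> is the trace of the product of the associated
    endomorphisms.\<close>
  define a where "a y u v = g (br y u) v" for y u v
  define s where "s y u v = a y u v + a y v u" for y u v
  define k where "k y u v = g (br u v) y" for y u v
  define t where "t \<alpha> \<beta> = (\<Sum>e\<in>B. \<Sum>b\<in>B. \<alpha> e b * \<beta> (d b) (d e))" for \<alpha> \<beta> :: "'a \<Rightarrow> 'a \<Rightarrow> real"
  have t_transpose: "t (\<lambda>u v. \<alpha> v u) (\<lambda>u v. \<beta> v u) = t \<alpha> \<beta>" for \<alpha> \<beta>
    unfolding t_def by (rule sum.swap)
  have t_add: "t (\<lambda>u v. \<alpha> u v + \<alpha>' u v) \<beta> = t \<alpha> \<beta> + t \<alpha>' \<beta>"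
    "t \<beta> (\<lambda>u v. \<alpha> u v + \<alpha>' u v) = t \<beta> \<alpha> + t \<beta> \<alpha>'" for \<alpha> \<alpha>' \<beta>
    by (simp_all add: t_def algebra_simps sum.distrib)
  have t_minus: "t (\<lambda>u v. - \<alpha> u v) \<beta> = - t \<alpha> \<beta>" "t \<beta> (\<lambda>u v. - \<alpha> u v) = - t \<beta> \<alpha>" for \<alpha> \<beta>
    by (simp_all add: t_def sum_negf)
  have k_skew: "(\<lambda>u v. k y v u) = (\<lambda>u v. - k y u v)" for y
    unfolding k_def by (intro ext, subst antisym) (simp add: glin)
  have s_sym: "(\<lambda>u v. s y v u) = s y" for y
    by (intro ext) (simp add: s_def)
  \<comment> \<open>Transposing both arguments preserves \<open>t\<close> but changes the sign
    here.\<close>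
  have sk: "t (s y) (k z) = 0"
    using t_transpose[of "s y" "k z"] by (simp add: s_sym k_skew t_minus)
  have ks: "t (k y) (s z) = 0"
    using t_transpose[of "k y" "s z"] by (simp add: s_sym k_skew t_minus)
  have kk: "t (k y) (k z) = - (\<Sum>e\<in>B. \<Sum>b\<in>B. g (br e b) y * g (br (d e) (d b)) z)"
    unfolding t_def k_def by (subst (2) antisym) (simp add: glin sum_negf)
  \<comment> \<open>This is the trace of ad \<open>z\<close> composed with ad \<open>y\<close>, a
    composition that is zero in step two.\<close>
  have aa: "t (a y) (a z) = 0"
  proof -
    have "(\<Sum>b\<in>B. g (br y e) b * g (br z (d b)) (d e)) = g (br z (br y e)) (d e)" for e
      by (rule linear_expand_dual[symmetric]) (auto intro!: linearI simp: glin blin)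
    then show ?thesis by (simp add: t_def a_def step bilinear_lzero[OF bil])
  qed
  have aTa: "t (\<lambda>u v. a y v u) (a z) = (\<Sum>e\<in>B. g (br y e) (br z (d e)))"
    unfolding t_def a_def by (subst sum.swap) (simp add: contract)
  have ss: "t (s y) (s z) = 2 * (\<Sum>e\<in>B. g (br y e) (br z (d e)))"
    using aa aTa t_transpose[of "a y" "a z"] t_transpose[of "a y" "\<lambda>u v. a z v u"]
    unfolding s_def[abs_def] t_add by simp
  \<comment> \<open>The trace of a product has both dual vectors in the second slots;
    \<open>t\<close> needs them in the same factor.\<close>
  have swap: "(\<Sum>b\<in>B. g (nab e y) (d b) * g (nab b z) (d e))
      = (\<Sum>b\<in>B. g (nab e y) b * g (nab (d b) z) (d e))" for e
    by (rule contraction_swap[where h = "\<lambda>b b'. g (nab e y) b' * g (nab b z) (d e)"])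
      (auto intro!: linearI simp: glin nlin algebra_simps)
  have "(\<Sum>b\<in>B. g (nab (nab b z) y) (d b))
      = (\<Sum>e\<in>B. \<Sum>b\<in>B. g (nab e y) (d b) * g (nab b z) (d e))"
    unfolding trace_compose[OF linear_nab_left] by (rule sum.swap)
  also have "\<dots> = (\<Sum>e\<in>B. \<Sum>b\<in>B. g (nab e y) b * g (nab (d b) z) (d e))"
    by (simp only: swap)
  finally have "4 * (\<Sum>b\<in>B. g (nab (nab b z) y) (d b))
      = (\<Sum>e\<in>B. \<Sum>b\<in>B. (2 * g (nab e y) b) * (2 * g (nab (d b) z) (d e)))"
    by (simp add: sum_distrib_left algebra_simps)
  also have "\<dots> = t (\<lambda>u v. s y u v + k y u v) (\<lambda>u v. s z u v + k z u v)"
    unfolding koszul t_def s_def a_def k_def by (simp only: minus_mult_minus)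
  finally show ?thesis
    unfolding t_add sk ks kk ss ricci_tensor_trace by simp
qed

section \<open>The full trace and the trace over the derived algebra\<close>

lemma contract_derived: "(\<Sum>b\<in>C. g (br u v) b * g (br x y) (d b)) = g (br u v) (br x y)"
proof -
  have "(\<Sum>b\<in>C. g (br u v) b * g (br x y) (d b)) = (\<Sum>b\<in>B. g (br u v) b * g (br x y) (d b))"
    by (rule sum.mono_neutral_left[OF fin C_subset]) (simp add: C_derived)
  then show ?thesis by (simp add: contract)
qed

text \<open>The index set is left open to serve both traces: \<open>A = B\<close> and
  \<open>A = C\<close>.\<close>

lemma sum_ricci_tensor:
  "4 * (\<Sum>i\<in>A. ricci_tensor br g i (d i)) =
    (\<Sum>e\<in>B. \<Sum>b\<in>B. \<Sum>i\<in>A. g (br e b) i * g (br (d e) (d b)) (d i))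
    - 2 * (\<Sum>i\<in>A. \<Sum>e\<in>B. g (br i e) (br (d i) (d e)))"
proof -
  have "(\<Sum>i\<in>A. \<Sum>e\<in>B. \<Sum>b\<in>B. g (br e b) i * g (br (d e) (d b)) (d i))
      = (\<Sum>e\<in>B. \<Sum>i\<in>A. \<Sum>b\<in>B. g (br e b) i * g (br (d e) (d b)) (d i))"
    by (rule sum.swap)
  also have "\<dots> = (\<Sum>e\<in>B. \<Sum>b\<in>B. \<Sum>i\<in>A. g (br e b) i * g (br (d e) (d b)) (d i))"
    by (rule sum.cong[OF refl], rule sum.swap)
  finally show ?thesis
    by (simp add: sum_distrib_left[of 4] ricci_tensor_formula sum_subtractf
        flip: sum_distrib_left[of 2])
qed

lemma trace_ricci:
  "4 * (\<Sum>b\<in>B. ricci_tensor br g b (d b)) = - (\<Sum>e\<in>B. \<Sum>b\<in>B. g (br e b) (br (d e) (d b)))"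
  unfolding sum_ricci_tensor contract by simp

lemma trace_ricci_derived:
  "4 * (\<Sum>b\<in>C. ricci_tensor br g b (d b)) = (\<Sum>e\<in>B. \<Sum>b\<in>B. g (br e b) (br (d e) (d b)))"
proof -
  have "br b x = 0" if "b \<in> C" for b x
    using C_central[OF that, of x] antisym[of b x] by simp
  then show ?thesis
    unfolding sum_ricci_tensor contract_derived by (simp add: bilinear_lzero[OF bil])
qed

lemma einstein_ricci_flat:
  assumes "einstein br g"
  shows "ricci_flat br g"
proof -
  obtain c where c: "ricci_operator br g = (\<lambda>x. c *\<^sub>R x)"
    using assms by (auto simp: einstein_def)
  have fd: "finite_dim TYPE('a)" using fin span_UNIV by (auto simp: finite_dim_def)
  have ric: "ricci_tensor br g b (d b) = c" if "b \<in> B" for b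
    using ricci_operator[OF fd lie metric, of b "d b"] that by (simp add: c glin dual_self)
  have "(\<Sum>b\<in>B. ricci_tensor br g b (d b)) = card B * c"
    "(\<Sum>b\<in>C. ricci_tensor br g b (d b)) = card C * c"
    using ric C_subset by (auto simp: subset_iff)
  then have "real (card B + card C) * c = 0"
    using trace_ricci trace_ricci_derived by (simp add: algebra_simps)
  then have "c = 0 \<or> card B = 0" by (auto simp flip: of_nat_add)
  \<comment> \<open>In dimension zero \<open>c\<close> is undetermined, but all operators
    coincide.\<close>
  then consider "c = 0" | "B = {}" using fin by auto
  then show ?thesis
  proof cases
    case 1
    then show ?thesis by (simp add: ricci_flat_def c)
  next
    case 2
    then have "x = 0" for x :: 'a using expand[of x] by simp
    then show ?thesis unfolding ricci_flat_def by blast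
  qed
qed

end

section \<open>A basis adapted to the derived algebra\<close>

theorem corollary2p5:
  fixes br :: "'a::real_vector \<Rightarrow> 'a \<Rightarrow> 'a"
  assumes "finite_dim TYPE('a)"
    and "lie_algebra br"
    and "step_two br"
  shows "\<forall>g. lie_metric g \<and> einstein br g \<longrightarrow> ricci_flat br g"
proof (intro allI impI, elim conjE)
  fix g :: "'a \<Rightarrow> 'a \<Rightarrow> real"
  assume g: "lie_metric g" and e: "einstein br g"
  have step: "br x (br y z) = 0" for x y z
    using assms(2,3) by (simp add: step_two_iff)
  \<comment> \<open>Choosing \<open>C\<close> among the brackets themselves, not in their span,
    makes its elements central directly by the step-two identity.\<close>
  define D where "D = {br x y | x y. True}"
  obtain C where C: "C \<subseteq> D" "independent C" "D \<subseteq> span C"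
    using maximal_independent_subset[of D] by metis
  obtain B where B: "C \<subseteq> B" "independent B" "UNIV \<subseteq> span B"
    using maximal_independent_subset_extend[of C UNIV] C(2) by auto
  have span: "span B = UNIV" using B(3) by auto
  have "linear (\<lambda>v. representation B v b)" for b
    by (rule linear_representation_basis[OF B(2) span])
  then have "\<exists>w. \<forall>v. g w v = representation B v b" for b
    using metric_represents[OF assms(1) g] by metis
  then obtain d where d: "\<And>b v. g (d b) v = representation B v b" by metis
  have derived: "g (br x y) (d b) = 0" if "b \<notin> C" for b x y
  proof -
    have "br x y \<in> span C" using C(3) by (auto simp: D_def)
    \<comment> \<open>Extending \<open>C\<close> to \<open>B\<close> does not change the coordinates
      of vectors in the span of \<open>C\<close>.\<close>
    then have "representation B (br x y) b = representation C (br x y) b"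
      using representation_extend[OF B(2) _ B(1)] by simp
    also have "\<dots> = 0" using representation_ne_zero that by blast
    finally show ?thesis using g by (subst (asm) d[symmetric]) (simp add: lie_metric_def)
  qed
  interpret step_two_dual_bases g B d br C
  proof unfold_locales
    show "finite B" by (rule finite_dim_independent_finite[OF assms(1) B(2)])
    show "br x b = 0" if "b \<in> C" for b x
      using that C(1) step by (auto simp: D_def)
  qed (use assms(2) g B(1,2) span d derived step in auto)
  show "ricci_flat br g" by (rule einstein_ricci_flat[OF e])
qed

end
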